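(* Let $\lambda_2,\ldots,\lambda_n$ be real numbers. If $1\geq\lambda_2\geq\cdots\geq\lambda_n\geq -1$ and $$1-(n-1)\lambda_2+\lambda_3+\cdots+\lambda_n\geq 0,\qquad 1+(n-1)\lambda_n\geq 0,$$ then there is an $n\times n$ nonsymmetric doubly stochastic matrix $D$ with spectrum $1,\lambda_2,\ldots,\lambda_n$.
   Context: An $n\times n$ real matrix is doubly stochastic if all its entries are nonnegative and each row sum and each column sum equals $1$. The spectrum is the list of eigenvalues counted with algebraic multiplicity.
   Formalization: D is claimed nonsymmetric except when n = 2, when λ_2 = 1 (then D = I), or when n = 3 and λ_2 = λ_3 = -1/2; in these cases every doubly stochastic matrix with the given spectrum is symmetric, and only existence of D with that spectrum is claimed. *)

theory Defs
  imports "Jordan_Normal_Form.Char_Poly"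
begin

definition doubly_stochastic :: "real mat \<Rightarrow> bool" where
  "doubly_stochastic A \<longleftrightarrow>
     square_mat A \<and>
     (\<forall>i<dim_row A. \<forall>j<dim_col A. A $$ (i, j) \<ge> 0) \<and>
     (\<forall>i<dim_row A. (\<Sum>j<dim_col A. A $$ (i, j)) = 1) \<and>
     (\<forall>j<dim_col A. (\<Sum>i<dim_row A. A $$ (i, j)) = 1)"

(* A doubly stochastic matrix of size 2, or with all eigenvalues 1, or of size 3
   with spectrum 1, -1/2, -1/2, is necessarily symmetric; a claim that some doubly
   stochastic matrix with given spectrum is nonsymmetric must exempt these cases. *)
definition symmetric_mat :: "'a mat \<Rightarrow> bool" where
  "symmetric_mat A \<longleftrightarrow> transpose_mat A = A"

(* The eigenvalues are taken over the complex numbers, so that no non-real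
   eigenvalue of a real matrix is lost; \<open>proots\<close> counts roots with multiplicity. *)
definition spectrum_mset :: "real mat \<Rightarrow> complex multiset" where
  "spectrum_mset A = proots (char_poly (map_mat complex_of_real A))"

end

theory Submission
  imports Defs
begin

text \<open>
  Let \<open>e\<^sub>0, \<dots>, e\<^sub>m\<close> (\<open>m = n - 1\<close>) be the unit vectors. If all column sums of a matrix \<open>A\<close> are
  \<open>1\<close>, then in the basis \<open>e\<^sub>0, e\<^sub>1 - e\<^sub>0, \<dots>, e\<^sub>m - e\<^sub>0\<close> its first row becomes \<open>(1, 0, \<dots>, 0)\<close>,
  and for \<open>i, j \<ge> 1\<close> its entry at \<open>(i, j)\<close> becomes \<open>A(i, j) - A(i, 0)\<close>. If in each row \<open>i \<ge> 1\<close>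
  all entries right of the diagonal equal the first entry of that row, the transformed matrix is
  lower triangular, so the spectrum of \<open>A\<close> can be read off: it consists of \<open>1\<close> and of the
  differences \<open>A(i, i) - A(i, 0)\<close>, see \<open>char_poly_unit_col_sums\<close>.

  It remains to choose the rows \<open>i \<ge> 1\<close>; the column sums then determine row \<open>0\<close>
  (\<open>complete_rows_doubly_stochastic\<close>). Take row \<open>i\<close> to be
  \<open>(1 - \<mu>)/n \<cdot> (1, \<dots>, 1) + \<mu> e\<^sub>i\<close>, where \<open>\<mu>\<close> is the eigenvalue for that row. Since all
  eigenvalues are at most \<open>1\<close>, the entries off the diagonal in these rows are nonnegative, and
  the two inequalities of the theorem amount to nonnegativity of the diagonal entries and of the
  completed row \<open>0\<close>. For \<open>n \<ge> 3\<close>, this matrix is symmetric only if \<open>\<lambda>\<^sub>2 = \<dots> = \<lambda>\<^sub>n\<close>.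

  If \<open>n \<ge> 3\<close> and these eigenvalues have a common value \<open>\<mu> < 1\<close>, all entries off the diagonal
  equal \<open>(1 - \<mu>)/n > 0\<close>. The last row is then changed so that its diagonal entry still exceeds
  its first entry by \<open>\<mu>\<close>; the criterion does not restrict the other entries left of the
  diagonal. For \<open>n \<ge> 4\<close> one moves mass from column \<open>2\<close> to column \<open>1\<close>. For \<open>n = 3\<close> column \<open>1\<close>
  is the only such column, and it receives mass from columns \<open>0\<close> and \<open>2\<close> in equal parts; this
  needs a positive diagonal entry, that is, \<open>\<mu> \<noteq> -1/2\<close>.
\<close>

section \<open>The characteristic polynomial of a matrix with unit column sums\<close>

lemma sum_mult_unit_row_indicator:
  fixes f :: "nat \<Rightarrow> 'a :: comm_ring_1"
  assumes "j < n"
  shows "(\<Sum>k = 0..<n. f k * (if k = j \<or> k = 0 then 1 else 0)) = f 0 + (if j = 0 then 0 else f j)"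
proof -
  have "(\<Sum>k = 0..<n. f k * (if k = j \<or> k = 0 then 1 else 0))
      = (\<Sum>k = 0..<n. (if k = 0 then f 0 else 0) + (if k = j then (if j = 0 then 0 else f j) else 0))"
    by (rule sum.cong) auto
  then show ?thesis
    using assms by (simp add: sum.distrib)
qed

lemma char_poly_unit_col_sums:
  fixes A :: "'a :: field mat"
  assumes A: "A \<in> carrier_mat n n" and n: "n \<ge> 1"
    and col_sum: "\<And>j. j < n \<Longrightarrow> (\<Sum>i<n. A $$ (i, j)) = 1"
    and right: "\<And>i j. 1 \<le> i \<Longrightarrow> i < j \<Longrightarrow> j < n \<Longrightarrow> A $$ (i, j) = A $$ (i, 0)"
  shows "char_poly A = [:-1, 1:] * (\<Prod>i\<leftarrow>[1..<n]. [:- (A $$ (i, i) - A $$ (i, 0)), 1:])"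
proof -
  \<comment> \<open>The columns of \<open>P\<close> are the basis \<open>e\<^sub>0, e\<^sub>1 - e\<^sub>0, \<dots>\<close>; \<open>Q\<close> is the inverse of \<open>P\<close>.\<close>
  define P :: "'a mat" where
    "P = mat n n (\<lambda>(i, j). if i = j then 1 else if i = 0 then -1 else 0)"
  define Q :: "'a mat" where
    "Q = mat n n (\<lambda>(i, j). if i = j \<or> i = 0 then 1 else 0)"
  define B :: "'a mat" where
    "B = mat n n (\<lambda>(i, j). if i = 0 then (if j = 0 then 1 else 0)
       else if j = 0 then A $$ (i, 0) else A $$ (i, j) - A $$ (i, 0))"
  have carrier [simp]: "P \<in> carrier_mat n n" "Q \<in> carrier_mat n n" "B \<in> carrier_mat n n"
    by (simp_all add: P_def Q_def B_def)
  have dims: "dim_row P = n" "dim_col P = n" "dim_row B = n" "dim_col B = n"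
    by (simp_all add: P_def B_def)
  have PQ: "P * Q = 1\<^sub>m n"
  proof (rule eq_matI)
    fix i j assume "i < dim_row (1\<^sub>m n :: 'a mat)" "j < dim_col (1\<^sub>m n :: 'a mat)"
    then have ij: "i < n" "j < n"
      by simp_all
    have "(P * Q) $$ (i, j) = (\<Sum>k = 0..<n. P $$ (i, k) * (if k = j \<or> k = 0 then 1 else 0))"
      using ij dims by (simp add: Q_def scalar_prod_def)
    also have "\<dots> = P $$ (i, 0) + (if j = 0 then 0 else P $$ (i, j))"
      by (rule sum_mult_unit_row_indicator[OF ij(2)])
    also have "\<dots> = 1\<^sub>m n $$ (i, j)"
      using ij by (simp add: P_def)
    finally show "(P * Q) $$ (i, j) = 1\<^sub>m n $$ (i, j)" .
  qed (simp_all add: P_def Q_def)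
  then have QP: "Q * P = 1\<^sub>m n"
    by (rule mat_mult_left_right_inverse[OF carrier(1,2)])
  have "Q * A = B * Q"
  proof (rule eq_matI)
    fix i j assume "i < dim_row (B * Q)" "j < dim_col (B * Q)"
    then have ij: "i < n" "j < n"
      by (simp_all add: B_def Q_def)
    have "(Q * A) $$ (i, j) = (\<Sum>k = 0..<n. (if i = k \<or> i = 0 then 1 else 0) * A $$ (k, j))"
      using ij A by (simp add: Q_def scalar_prod_def)
    also have "\<dots> = (if i = 0 then 1 else A $$ (i, j))"
      using ij col_sum[OF ij(2)] by (simp add: atLeast0LessThan if_distrib[of "\<lambda>x. x * _"] cong: if_cong)
    also have "\<dots> = B $$ (i, 0) + (if j = 0 then 0 else B $$ (i, j))"
      using ij by (simp add: B_def)
    also have "\<dots> = (\<Sum>k = 0..<n. B $$ (i, k) * (if k = j \<or> k = 0 then 1 else 0))"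
      by (rule sum_mult_unit_row_indicator[OF ij(2), symmetric])
    also have "\<dots> = (B * Q) $$ (i, j)"
      using ij dims by (simp add: Q_def scalar_prod_def)
    finally show "(Q * A) $$ (i, j) = (B * Q) $$ (i, j)" .
  qed (use A in \<open>auto simp: B_def Q_def\<close>)
  then have "P * B * Q = P * (Q * A)"
    using assoc_mult_mat[OF carrier(1,3,2)] by simp
  also have "\<dots> = A"
    using assoc_mult_mat[OF carrier(1,2) A] PQ A by simp
  finally have "A = P * B * Q" ..
  then have "similar_mat A B"
    using A PQ QP by (intro similar_matI) auto
  then have "char_poly A = char_poly (transpose_mat B)"
    using char_poly_similar char_poly_transpose_mat[OF carrier(3)] by metis
  also have "\<dots> = (\<Prod>a\<leftarrow>diag_mat (transpose_mat B). [:- a, 1:])"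
  proof (rule char_poly_upper_triangular)
    show "transpose_mat B \<in> carrier_mat n n"
      by simp
    show "upper_triangular (transpose_mat B)"
      using right unfolding upper_triangular_def by (auto simp: B_def)
  qed
  also have "diag_mat (transpose_mat B) = map (\<lambda>i. B $$ (i, i)) (0 # [1..<n])"
    using n by (simp add: diag_mat_def B_def upt_conv_Cons)
  also have "\<dots> = 1 # map (\<lambda>i. A $$ (i, i) - A $$ (i, 0)) [1..<n]"
    using n by (auto simp: B_def)
  finally show ?thesis
    by (simp add: o_def)
qed

lemma spectrum_unit_col_sums:
  fixes A :: "real mat"
  assumes A: "A \<in> carrier_mat n n" and n: "n \<ge> 1"
    and col_sum: "\<And>j. j < n \<Longrightarrow> (\<Sum>i<n. A $$ (i, j)) = 1"
    and right: "\<And>i j. 1 \<le> i \<Longrightarrow> i < j \<Longrightarrow> j < n \<Longrightarrow> A $$ (i, j) = A $$ (i, 0)"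
  shows "spectrum_mset A = image_mset complex_of_real
           (add_mset 1 (image_mset (\<lambda>i. A $$ (i, i) - A $$ (i, 0)) (mset_set {1..<n})))"
proof -
  let ?C = "map_mat complex_of_real A"
  let ?d = "\<lambda>i. A $$ (i, i) - A $$ (i, 0)"
  have "char_poly ?C = [:-1, 1:] * (\<Prod>i\<leftarrow>[1..<n]. [:- (?C $$ (i, i) - ?C $$ (i, 0)), 1:])"
  proof (rule char_poly_unit_col_sums)
    show "(\<Sum>i<n. ?C $$ (i, j)) = 1" if "j < n" for j
      using A that arg_cong[OF col_sum[OF that], of complex_of_real] by simp
  qed (use A n right in auto)
  also have "(\<Prod>i\<leftarrow>[1..<n]. [:- (?C $$ (i, i) - ?C $$ (i, 0)), 1:])
      = (\<Prod>i\<in>{1..<n}. [:- complex_of_real (?d i), 1:])"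
    using A by (subst prod.distinct_set_conv_list[symmetric]) (auto intro!: prod.cong)
  finally have "spectrum_mset A
      = proots ([:-1, 1:] * (\<Prod>i\<in>{1..<n}. [:- complex_of_real (?d i), 1:]))"
    by (simp only: spectrum_mset_def)
  also have "\<dots> = {#1#} + (\<Sum>i\<in>{1..<n}. {#complex_of_real (?d i)#})"
    by (subst proots_mult) (auto simp: proots_prod simp del: mult_pCons_left)
  also have "(\<Sum>i\<in>{1..<n}. {#complex_of_real (?d i)#})
      = image_mset (\<lambda>i. complex_of_real (?d i)) (mset_set {1..<n})"
    by (simp add: sum_unfold_sum_mset)
  finally show ?thesis
    by (simp add: multiset.map_comp o_def)
qed

section \<open>Completing the rows below the first\<close>

text \<open>
  The \<open>n \<times> n\<close> matrix whose rows \<open>1, \<dots>, n - 1\<close> are those of \<open>R\<close> and whose row \<open>0\<close> makes all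
  column sums equal to \<open>1\<close>. The values \<open>R 0 j\<close> are not used.
\<close>
definition complete_rows :: "nat \<Rightarrow> (nat \<Rightarrow> nat \<Rightarrow> real) \<Rightarrow> real mat" where
  "complete_rows n R =
     mat n n (\<lambda>(i, j). if i = 0 then 1 - (\<Sum>k = 1..<n. R k j) else R i j)"

lemma complete_rows_carrier: "complete_rows n R \<in> carrier_mat n n"
  by (simp add: complete_rows_def)

lemma complete_rows_index:
  "i < n \<Longrightarrow> j < n \<Longrightarrow>
   complete_rows n R $$ (i, j) = (if i = 0 then 1 - (\<Sum>k = 1..<n. R k j) else R i j)"
  by (simp add: complete_rows_def)

lemma sum_lessThan_split_first:
  fixes f :: "nat \<Rightarrow> 'a :: comm_monoid_add"
  assumes "n \<ge> 1"
  shows "(\<Sum>i<n. f i) = f 0 + (\<Sum>i = 1..<n. f i)"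
  using assms by (simp add: lessThan_atLeast0 sum.atLeast_Suc_lessThan)

lemma complete_rows_col_sum:
  assumes "j < n"
  shows "(\<Sum>i<n. complete_rows n R $$ (i, j)) = 1"
proof -
  have "(\<Sum>i = 1..<n. complete_rows n R $$ (i, j)) = (\<Sum>i = 1..<n. R i j)"
    using assms by (intro sum.cong) (auto simp: complete_rows_index)
  then show ?thesis
    using assms by (simp add: sum_lessThan_split_first complete_rows_index)
qed

lemma complete_rows_doubly_stochastic:
  assumes n: "n \<ge> 1"
    and nonneg: "\<And>i j. 1 \<le> i \<Longrightarrow> i < n \<Longrightarrow> j < n \<Longrightarrow> R i j \<ge> 0"
    and row_sum: "\<And>i. 1 \<le> i \<Longrightarrow> i < n \<Longrightarrow> (\<Sum>j<n. R i j) = 1"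
    and col_le: "\<And>j. j < n \<Longrightarrow> (\<Sum>i = 1..<n. R i j) \<le> 1"
  shows "doubly_stochastic (complete_rows n R)"
proof -
  let ?D = "complete_rows n R"
  have "?D $$ (i, j) \<ge> 0" if "i < n" "j < n" for i j
    using that nonneg[of i j] col_le[of j] by (simp add: complete_rows_index)
  moreover have "(\<Sum>j<n. ?D $$ (i, j)) = 1" if "i < n" for i
  proof (cases "i = 0")
    case True
    \<comment> \<open>All entries add up to \<open>n\<close>, and the other rows contribute \<open>n - 1\<close>.\<close>
    have "(\<Sum>j<n. ?D $$ (i, j)) = (\<Sum>j<n. 1 - (\<Sum>k = 1..<n. R k j))"
      using True that by (intro sum.cong) (auto simp: complete_rows_index)
    also have "\<dots> = real n - (\<Sum>k = 1..<n. \<Sum>j<n. R k j)"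
      by (simp add: sum_subtractf sum.swap[of _ "{..<n}"])
    also have "(\<Sum>k = 1..<n. \<Sum>j<n. R k j) = real n - 1"
      using n by (simp add: row_sum)
    finally show ?thesis
      by simp
  next
    case False
    have "(\<Sum>j<n. ?D $$ (i, j)) = (\<Sum>j<n. R i j)"
      using False that by (intro sum.cong) (auto simp: complete_rows_index)
    then show ?thesis
      using row_sum[of i] that False by simp
  qed
  ultimately show ?thesis
    using complete_rows_col_sum[of _ n R]
    by (auto simp: doubly_stochastic_def complete_rows_def)
qed

lemma complete_rows_spectrum:
  assumes n: "n \<ge> 1"
    and right: "\<And>i j. 1 \<le> i \<Longrightarrow> i < j \<Longrightarrow> j < n \<Longrightarrow> R i j = R i 0"
    and diag: "\<And>i. 1 \<le> i \<Longrightarrow> i < n \<Longrightarrow> R i i - R i 0 = lam (i + 1)"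
  shows "spectrum_mset (complete_rows n R) =
           image_mset complex_of_real (add_mset 1 (image_mset lam (mset_set {2..n})))"
proof -
  let ?D = "complete_rows n R"
  have "spectrum_mset ?D = image_mset complex_of_real
      (add_mset 1 (image_mset (\<lambda>i. ?D $$ (i, i) - ?D $$ (i, 0)) (mset_set {1..<n})))"
    using n right complete_rows_col_sum
    by (intro spectrum_unit_col_sums) (auto simp: complete_rows_carrier complete_rows_index)
  also have "image_mset (\<lambda>i. ?D $$ (i, i) - ?D $$ (i, 0)) (mset_set {1..<n})
      = image_mset (lam \<circ> Suc) (mset_set {1..<n})"
    using diag by (intro image_mset_cong) (auto simp: complete_rows_index)
  also have "\<dots> = image_mset lam (mset_set {2..n})"
  proof -
    have "Suc ` {1..<n} = {2..n}"
      by (simp add: atLeastLessThanSuc_atLeastAtMost numeral_2_eq_2)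
    then have "mset_set {2..n} = image_mset Suc (mset_set {1..<n})"
      using image_mset_mset_set[of Suc "{1..<n}"] by simp
    then show ?thesis
      by (simp add: multiset.map_comp)
  qed
  finally show ?thesis .
qed

lemma complete_rows_not_symmetric:
  assumes "1 \<le> i" "i < n" "1 \<le> j" "j < n" "R i j \<noteq> R j i"
  shows "\<not> symmetric_mat (complete_rows n R)"
proof
  assume "symmetric_mat (complete_rows n R)"
  then have "complete_rows n R $$ (i, j) = transpose_mat (complete_rows n R) $$ (i, j)"
    by (simp add: symmetric_mat_def)
  also have "\<dots> = complete_rows n R $$ (j, i)"
    using assms by (simp add: complete_rows_def)
  finally show False
    using assms by (simp add: complete_rows_index)
qed

section \<open>The choice of the rows\<close>

text \<open>
  The spectrum is \<open>1, \<lambda>\<^sub>2, \<dots>, \<lambda>\<^sub>n\<close> and rows count from \<open>0\<close>, so that row \<open>i\<close> belongs to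
  \<open>\<lambda>\<^bsub>i+1\<^esub>\<close>. This is the matrix used unless all of \<open>\<lambda>\<^sub>2, \<dots>, \<lambda>\<^sub>n\<close> are equal.
\<close>
definition base_rows :: "nat \<Rightarrow> (nat \<Rightarrow> real) \<Rightarrow> nat \<Rightarrow> nat \<Rightarrow> real" where
  "base_rows n lam i j = (1 - lam (i + 1)) / real n + (if i = j then lam (i + 1) else 0)"

lemma sum_base_rows_row:
  assumes "i < n"
  shows "(\<Sum>j<n. base_rows n lam i j) = 1"
  using assms by (simp add: base_rows_def sum.distrib)

lemma sum_base_rows_col:
  assumes n: "n \<ge> 1" and j: "j < n"
  shows "(\<Sum>i = 1..<n. base_rows n lam i j) =
           (real n - 1 - (\<Sum>i = 2..n. lam i)) / real n + (if j = 0 then 0 else lam (j + 1))"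
proof -
  have "(\<Sum>i = 2..n. lam i) = (\<Sum>i = 1..<n. lam (i + 1))"
    using sum.shift_bounds_Suc_ivl[of lam 1 n]
    by (simp add: atLeastLessThanSuc_atLeastAtMost numeral_2_eq_2)
  moreover have "(\<Sum>i = 1..<n. if i = j then lam (i + 1) else 0)
      = (if j = 0 then 0 else lam (j + 1))"
    using j by (simp add: sum.delta)
  ultimately show ?thesis
    using n by (simp add: base_rows_def sum.distrib sum_divide_distrib[symmetric] sum_subtractf
        of_nat_diff)
qed

lemma base_rows_nonneg:
  assumes "n \<ge> 1" "lam (i + 1) \<le> 1" "1 + (real n - 1) * lam (i + 1) \<ge> 0"
  shows "base_rows n lam i j \<ge> 0"
proof -
  have "base_rows n lam i i = (1 + (real n - 1) * lam (i + 1)) / real n"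
    using assms(1) by (simp add: base_rows_def field_simps)
  then show ?thesis
    using assms by (cases "i = j") (auto simp: base_rows_def)
qed

lemma base_rows_col_le:
  assumes n: "n \<ge> 1" and j: "j < n"
    and "1 + (\<Sum>i = 2..n. lam i) \<ge> (if j = 0 then 0 else real n * lam (j + 1))"
  shows "(\<Sum>i = 1..<n. base_rows n lam i j) \<le> 1"
  unfolding sum_base_rows_col[OF n j] using assms by (auto simp: field_simps)

theorem theorem3p4:
  fixes n :: nat and lam :: "nat \<Rightarrow> real"
  assumes "n \<ge> 2"
    and "1 \<ge> lam 2"
    and "\<And>i. 2 \<le> i \<Longrightarrow> i < n \<Longrightarrow> lam i \<ge> lam (i + 1)"
    and "lam n \<ge> -1"
    and "1 - (real n - 1) * lam 2 + (\<Sum>i = 3..n. lam i) \<ge> 0"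
    and "1 + (real n - 1) * lam n \<ge> 0"
  shows "\<exists>D \<in> carrier_mat n n.
           doubly_stochastic D \<and>
           spectrum_mset D =
             image_mset complex_of_real (add_mset 1 (image_mset lam (mset_set {2..n}))) \<and>
           (n \<ge> 3 \<and> lam 2 \<noteq> 1 \<and> \<not> (n = 3 \<and> lam 2 = - 1/2 \<and> lam 3 = - 1/2)
              \<longrightarrow> \<not> symmetric_mat D)"
proof -
  have antimono: "lam j \<le> lam i" if "2 \<le> i" "i \<le> j" "j \<le> n" for i j
    using that(2,3)
  proof (induction j rule: dec_induct)
    case (step k)
    then show ?case
      using assms(3)[of k] that(1) by simp
  qed simp
  have le_one: "lam i \<le> 1" if "2 \<le> i" "i \<le> n" for i
    using antimono[of 2 i] assms(2) that by simp
  have diag_nonneg: "1 + (real n - 1) * lam i \<ge> 0" if "2 \<le> i" "i \<le> n" for i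
  proof -
    have "(real n - 1) * lam n \<le> (real n - 1) * lam i"
      using antimono[of i n] that assms(1) by (intro mult_left_mono) auto
    then show ?thesis
      using assms(6) by simp
  qed
  have sum_ge: "1 + (\<Sum>i = 2..n. lam i) \<ge> real n * lam i" if "2 \<le> i" "i \<le> n" for i
  proof -
    have "(\<Sum>i = 2..n. lam i) = lam 2 + (\<Sum>i = 3..n. lam i)"
    proof -
      have "{2..n} = insert 2 {3..n}"
        using assms(1) by auto
      then show ?thesis
        by simp
    qed
    moreover have "real n * lam i \<le> real n * lam 2"
      using antimono[of 2 i] that by (intro mult_left_mono) auto
    ultimately show ?thesis
      using assms(5) by (simp add: algebra_simps)
  qed
  have sum_nonneg: "1 + (\<Sum>i = 2..n. lam i) \<ge> 0"
  proof -
    have "(\<Sum>i = 2..n. lam i) \<ge> (\<Sum>i = 2..n. lam n)"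
      using antimono by (intro sum_mono) auto
    moreover have "(\<Sum>i = 2..n. lam n) = (real n - 1) * lam n"
      using assms(1) by (simp add: of_nat_diff)
    ultimately show ?thesis
      using assms(6) by linarith
  qed
  have base_nonneg: "base_rows n lam i j \<ge> 0" if "1 \<le> i" "i < n" for i j
    using base_rows_nonneg[of n lam i j] le_one diag_nonneg that by simp
  have base_col_le: "(\<Sum>i = 1..<n. base_rows n lam i j) \<le> 1" if "j < n" for j
    using base_rows_col_le[of n j lam] sum_ge[of "j + 1"] sum_nonneg that assms(1) by auto
  \<comment> \<open>It suffices to exhibit the rows \<open>1, \<dots>, n - 1\<close>; an asymmetry is sought outside row and column \<open>0\<close>.\<close>
  have suffices: ?thesis
    if "\<And>i j. 1 \<le> i \<Longrightarrow> i < n \<Longrightarrow> j < n \<Longrightarrow> R i j \<ge> 0"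
      and "\<And>i. 1 \<le> i \<Longrightarrow> i < n \<Longrightarrow> (\<Sum>j<n. R i j) = 1"
      and "\<And>j. j < n \<Longrightarrow> (\<Sum>i = 1..<n. R i j) \<le> 1"
      and "\<And>i j. 1 \<le> i \<Longrightarrow> i < j \<Longrightarrow> j < n \<Longrightarrow> R i j = R i 0"
      and "\<And>i. 1 \<le> i \<Longrightarrow> i < n \<Longrightarrow> R i i - R i 0 = lam (i + 1)"
      and nonsym: "n \<ge> 3 \<and> lam 2 \<noteq> 1 \<and> \<not> (n = 3 \<and> lam 2 = - 1/2 \<and> lam 3 = - 1/2)
            \<Longrightarrow> \<exists>i j. 1 \<le> i \<and> i < n \<and> 1 \<le> j \<and> j < n \<and> R i j \<noteq> R j i"
    for R
  proof (intro bexI[of _ "complete_rows n R"] conjI impI)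
    show "doubly_stochastic (complete_rows n R)"
      using assms(1) that by (intro complete_rows_doubly_stochastic) auto
    show "spectrum_mset (complete_rows n R) =
        image_mset complex_of_real (add_mset 1 (image_mset lam (mset_set {2..n})))"
      using assms(1) that by (intro complete_rows_spectrum) auto
    show "\<not> symmetric_mat (complete_rows n R)"
      if "n \<ge> 3 \<and> lam 2 \<noteq> 1 \<and> \<not> (n = 3 \<and> lam 2 = - 1/2 \<and> lam 3 = - 1/2)"
      using nonsym[OF that] complete_rows_not_symmetric by blast
  qed (rule complete_rows_carrier)
  define a where "a = (1 - lam 2) / real n"
  consider (base) "n = 2 \<or> lam 2 = 1 \<or> lam n \<noteq> lam 2 \<or> (n = 3 \<and> lam 2 = - 1/2)"
    | (equal3) "n = 3" "lam 2 \<noteq> 1" "lam n = lam 2" "lam 2 \<noteq> - 1/2"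
    | (equal4) "n \<ge> 4" "lam 2 \<noteq> 1" "lam n = lam 2"
  proof -
    have "n = 2 \<or> n = 3 \<or> n \<ge> 4"
      using assms(1) by linarith
    then show thesis
      using base equal3 equal4 by blast
  qed
  then show ?thesis
  proof cases
    case base
    have "\<exists>i j. 1 \<le> i \<and> i < n \<and> 1 \<le> j \<and> j < n \<and> base_rows n lam i j \<noteq> base_rows n lam j i"
      if "n \<ge> 3 \<and> lam 2 \<noteq> 1 \<and> \<not> (n = 3 \<and> lam 2 = - 1/2 \<and> lam 3 = - 1/2)"
    proof -
      have "n \<noteq> 2"
        using that by simp
      then have "lam n \<noteq> lam 2"
        using base that by metis
      moreover have less: "1 < n - 1"
        using that by linarith
      have "base_rows n lam 1 (n - 1) = (1 - lam 2) / real n"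
        using less by (simp add: base_rows_def numeral_2_eq_2)
      moreover have "base_rows n lam (n - 1) 1 = (1 - lam n) / real n"
        using less by (simp add: base_rows_def)
      ultimately have "base_rows n lam 1 (n - 1) \<noteq> base_rows n lam (n - 1) 1"
        using that by simp
      then show ?thesis
        using that by (intro exI[of _ 1] exI[of _ "n - 1"]) auto
    qed
    then show ?thesis
      using base_nonneg base_col_le sum_base_rows_row
      by (intro suffices[of "base_rows n lam"]) (auto simp: base_rows_def)
  next
    case equal3
    have a: "a > 0"
      using assms(2) equal3 by (simp add: a_def)
    have "1 + 2 * lam 2 > 0"
      using diag_nonneg[of 2] equal3 by (simp add: less_le)
    then have diag: "a + lam 2 > 0"
      using equal3 by (simp add: a_def field_simps)
    \<comment> \<open>The bound \<open>a / 2\<close> keeps the completed entry \<open>(0, 1)\<close> nonnegative.\<close>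
    define e where "e = min (a / 2) (a + lam 2)"
    have e: "e > 0" "e \<le> a / 2" "e \<le> a + lam 2"
      using a diag unfolding e_def by linarith+
    have sum1: "3 * a + lam 2 = 1"
      using equal3 by (simp add: a_def field_simps)
    define R where
      "R = (\<lambda>(i :: nat) (j :: nat). if i = 1 then a + (if j = 1 then lam 2 else 0)
         else if j = 0 then a - e else if j = 1 then a + 2 * e else a + lam 2 - e)"
    have sets: "{..<n} = {0, 1, 2}" "{1..<n} = {1, 2}"
      using equal3(1) by auto
    have row_cases: "i = 1 \<or> i = 2" if "1 \<le> i" "i < n" for i
      using that equal3(1) by linarith
    show ?thesis
    proof (rule suffices[of R])
      show "R i j \<ge> 0" if "1 \<le> i" "i < n" "j < n" for i j
        using a diag e by (auto simp: R_def)
      show "(\<Sum>j<n. R i j) = 1" if "1 \<le> i" "i < n" for i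
        using sum1 by (simp add: sets R_def)
      show "(\<Sum>i = 1..<n. R i j) \<le> 1" if "j < n" for j
        using sum1 e a unfolding sets by (simp add: R_def)
      show "R i j = R i 0" if "1 \<le> i" "i < j" "j < n" for i j
        using that equal3(1) by (auto simp: R_def)
      show "R i i - R i 0 = lam (i + 1)" if "1 \<le> i" "i < n" for i
        using row_cases[OF that] equal3 by (auto simp: R_def numeral_2_eq_2 numeral_3_eq_3)
      show "\<exists>i j. 1 \<le> i \<and> i < n \<and> 1 \<le> j \<and> j < n \<and> R i j \<noteq> R j i"
        using e equal3(1) by (intro exI[of _ 1] exI[of _ 2]) (auto simp: R_def)
    qed
  next
    case equal4
    have lam_eq: "lam i = lam 2" if "2 \<le> i" "i \<le> n" for i
      using antimono[of 2 i] antimono[of i n] that equal4(3) by simp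
    have a: "a > 0"
      using assms(2) equal4 by (auto simp: a_def)
    \<comment> \<open>As \<open>n - 1 \<ge> 3\<close>, the columns \<open>1\<close> and \<open>2\<close> lie left of the diagonal in the last row.\<close>
    define c where "c = (\<lambda>j :: nat. (if j = 1 then a else 0) - (if j = 2 then a else 0))"
    define R where "R = (\<lambda>i j. base_rows n lam i j + (if i = n - 1 then c j else 0))"
    have base_eq: "base_rows n lam i j = a" if "1 \<le> i" "i < n" "i \<noteq> j" for i j
      using that lam_eq[of "i + 1"] by (simp add: base_rows_def a_def)
    have sum_c: "(\<Sum>j<n. c j) = 0"
      using equal4(1) by (simp add: c_def sum_subtractf)
    have c_zero: "c j = 0" if "j \<noteq> 1" "j \<noteq> 2" for j
      using that by (simp add: c_def)
    show ?thesis
    proof (rule suffices[of R])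
      show "R i j \<ge> 0" if "1 \<le> i" "i < n" "j < n" for i j
        using base_nonneg[of i j] base_eq[of i j] that a equal4(1) by (auto simp: R_def c_def)
      show "(\<Sum>j<n. R i j) = 1" if "1 \<le> i" "i < n" for i
        using that sum_base_rows_row[of i n lam] sum_c
        by (cases "i = n - 1") (simp_all add: R_def sum.distrib)
      show "(\<Sum>i = 1..<n. R i j) \<le> 1" if "j < n" for j
      proof (cases "j = 1")
        case True
        have "(\<Sum>i = 2..n. lam i) = (\<Sum>i = 2..n. lam 2)"
          by (intro sum.cong refl lam_eq) auto
        then have "(\<Sum>i = 2..n. lam i) = (real n - 1) * lam 2"
          using assms(1) by (simp add: of_nat_diff)
        moreover have "(\<Sum>i = 1..<n. base_rows n lam i j)
            = (real n - 1 - (\<Sum>i = 2..n. lam i)) / real n + lam 2"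
          using sum_base_rows_col[of n j lam] True equal4(1) by (simp add: numeral_2_eq_2)
        ultimately have "(\<Sum>i = 1..<n. base_rows n lam i j) = 1 - a"
          using equal4(1) by (simp add: a_def field_simps)
        then show ?thesis
          using True a by (simp add: R_def sum.distrib c_def)
      next
        case False
        then have "c j \<le> 0"
          using a by (simp add: c_def)
        then show ?thesis
          using base_col_le[OF that] equal4(1) by (simp add: R_def sum.distrib)
      qed
      show "R i j = R i 0" if "1 \<le> i" "i < j" "j < n" for i j
        using that base_eq[of i j] base_eq[of i 0] by (auto simp: R_def)
      show "R i i - R i 0 = lam (i + 1)" if "1 \<le> i" "i < n" for i
        using that equal4(1) c_zero[of i] c_zero[of 0] by (auto simp: R_def base_rows_def)
      have "R (n - 1) 1 \<noteq> R 1 (n - 1)"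
        using base_eq[of "n - 1" 1] base_eq[of 1 "n - 1"] a equal4(1) by (simp add: R_def c_def)
      then show "\<exists>i j. 1 \<le> i \<and> i < n \<and> 1 \<le> j \<and> j < n \<and> R i j \<noteq> R j i"
        using equal4(1) by (intro exI[of _ "n - 1"] exI[of _ 1]) auto
    qed
  qed
qed

end
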